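(* Let $\lambda>0$ and let $\pi_1,\dots,\pi_M$ be the sampling probabilities. Consider the minimax game $$\min_{\boldsymbol G_d,\,C_d}\ \max_{D_d}\ \ \mathbb{E}_{x\sim P_{data}^d}[\log D_d(x)]+\sum_{m=1}^M \pi_m\,\mathbb{E}_{z\sim P_z}\big[\log\big(1-D_d(G_d^m(z))\big)\big]-\lambda\sum_{m=1}^M\pi_m\,\mathbb{E}_{\hat x\sim P_{G_d^m}}\big[\log C_d^m(\hat x)\big].$$ Given the optimal discriminator and the optimal classifier (i.e. when, for each choice of generators $\boldsymbol G_d$, $D_d$ is taken to be the maximizer and $C_d$ the minimizer of the game objective for these generators), the objective of the generators is to minimize $2\,\mathrm{JSD}(P_{data}^d\|P_{model}^d)-\lambda\,\mathrm{JSD}_{\pi_1,\dots,\pi_M}(P_{G_d^1},\dots,P_{G_d^M})$; that is, the optimal generators satisfy $$\boldsymbol G_d^*=\mathop{\arg\min}_{\boldsymbol G_d}\Big(2\,\mathrm{JSD}(P_{data}^d\,\|\,P_{model}^d)-\lambda\,\mathrm{JSD}_{\pi_1,\pi_2,\dots,\pi_M}(P_{G_d^1},P_{G_d^2},\dots,P_{G_d^M})\Big).$$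
   Context: Fix an index $d$ of a local dataset whose real data distribution has probability density $P_{data}^d$ on the sample space. There are $M$ generators $\boldsymbol G_d=\{G_d^1,\dots,G_d^M\}$; generator $G_d^m$ maps noise $z\sim P_z$ to a synthetic sample $G_d^m(z)$, and $P_{G_d^m}$ denotes the probability density of $G_d^m(z)$. The sampling probabilities (mixture weights) $\pi_1,\dots,\pi_M$ are fixed, nonnegative and sum to $1$; the combined synthetic data have density $P_{model}^d(x)=\sum_{m=1}^M\pi_m P_{G_d^m}(x)$. The discriminator $D_d$ is a function from the sample space to $[0,1]$. The classifier is $C_d=(C_d^1,\dots,C_d^M)$ with $C_d^m(x)\ge 0$ and $\sum_{m=1}^M C_d^m(x)=1$. The analysis is non-parametric: $D_d$ and $C_d$ range over all measurable functions of this kind. For probability densities $P,Q$, $\mathrm{JSD}(P\|Q)=\tfrac12\mathrm{KL}\big(P\,\|\,\tfrac{P+Q}{2}\big)+\tfrac12\mathrm{KL}\big(Q\,\|\,\tfrac{P+Q}{2}\big)$ is the Jensen-Shannon divergence, where $\mathrm{KL}$ is the Kullback-Leibler divergence. The generalized Jensen-Shannon divergence is $\mathrm{JSD}_{\pi_1,\dots,\pi_M}(P_1,\dots,P_M)=\sum_{m=1}^M\pi_m\,\mathrm{KL}\big(P_m\,\|\,\sum_{i=1}^M\pi_iP_i\big)$. *)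

theory Defs
  imports "HOL-Probability.Probability"
begin

definition prob_density :: "'a measure \<Rightarrow> ('a \<Rightarrow> real) \<Rightarrow> bool" where
  "prob_density \<mu> p \<longleftrightarrow>
     p \<in> borel_measurable \<mu> \<and> (\<forall>x\<in>space \<mu>. 0 \<le> p x) \<and> (\<integral>\<^sup>+x. ennreal (p x) \<partial>\<mu>) = 1"

(* The library's KL_divergence takes the reference measure first, so this is KL(P || Q).
   It is a Bochner integral, hence 0 rather than infinity in the divergent case.  Below, Q is a
   mixture that contains P.  If P has positive weight then dP/dQ is bounded, the integral
   converges, and the value is the usual one.  If P has weight 0 then the KL term is multiplied
   by 0, which agrees with the convention 0 * infinity = 0. *)
definition KL :: "'a measure \<Rightarrow> ('a \<Rightarrow> real) \<Rightarrow> ('a \<Rightarrow> real) \<Rightarrow> real" where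
  "KL \<mu> P Q = KL_divergence (exp 1) (density \<mu> (\<lambda>x. ennreal (Q x))) (density \<mu> (\<lambda>x. ennreal (P x)))"

definition JSD :: "'a measure \<Rightarrow> ('a \<Rightarrow> real) \<Rightarrow> ('a \<Rightarrow> real) \<Rightarrow> real" where
  "JSD \<mu> P Q = 1/2 * KL \<mu> P (\<lambda>x. (P x + Q x) / 2) + 1/2 * KL \<mu> Q (\<lambda>x. (P x + Q x) / 2)"

definition mixture :: "nat \<Rightarrow> (nat \<Rightarrow> real) \<Rightarrow> (nat \<Rightarrow> 'a \<Rightarrow> real) \<Rightarrow> 'a \<Rightarrow> real" where
  "mixture M w P x = (\<Sum>m=1..M. w m * P m x)"

definition gen_JSD :: "'a measure \<Rightarrow> nat \<Rightarrow> (nat \<Rightarrow> real) \<Rightarrow> (nat \<Rightarrow> 'a \<Rightarrow> real) \<Rightarrow> real" where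
  "gen_JSD \<mu> M w P = (\<Sum>m=1..M. w m * KL \<mu> (P m) (mixture M w P))"

definition elog :: "real \<Rightarrow> ereal" where
  "elog t = (if t \<le> 0 then -\<infinity> else ereal (ln t))"

(* Positive part minus negative part: e2ennreal truncates negative arguments to 0. *)
definition eexpect :: "'b measure \<Rightarrow> ('b \<Rightarrow> ereal) \<Rightarrow> ereal" where
  "eexpect N f = enn2ereal (\<integral>\<^sup>+x. e2ennreal (f x) \<partial>N) - enn2ereal (\<integral>\<^sup>+x. e2ennreal (- f x) \<partial>N)"

definition discriminators :: "'a measure \<Rightarrow> ('a \<Rightarrow> real) set" where
  "discriminators \<mu> = {D \<in> borel_measurable \<mu>. \<forall>x\<in>space \<mu>. 0 \<le> D x \<and> D x \<le> 1}"

definition classifiers :: "'a measure \<Rightarrow> nat \<Rightarrow> (nat \<Rightarrow> 'a \<Rightarrow> real) set" where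
  "classifiers \<mu> M = {C. (\<forall>m\<in>{1..M}. C m \<in> borel_measurable \<mu>) \<and>
     (\<forall>x\<in>space \<mu>. (\<forall>m\<in>{1..M}. 0 \<le> C m x) \<and> (\<Sum>m=1..M. C m x) = 1)}"

(* dens assigns to each generator the density of its output.  The first two summands are at most 0
   and the subtracted sum is at most 0, so the only indeterminate value is -\<infinity> + \<infinity>, which ereal
   evaluates to \<infinity>: a classifier of infinite loss has infinite loss against every discriminator. *)
definition game_objective ::
  "'a measure \<Rightarrow> 'z measure \<Rightarrow> ('a \<Rightarrow> real) \<Rightarrow> nat \<Rightarrow> (nat \<Rightarrow> real) \<Rightarrow> real \<Rightarrow>
   (('z \<Rightarrow> 'a) \<Rightarrow> 'a \<Rightarrow> real) \<Rightarrow>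
   (nat \<Rightarrow> 'z \<Rightarrow> 'a) \<Rightarrow> (nat \<Rightarrow> 'a \<Rightarrow> real) \<Rightarrow> ('a \<Rightarrow> real) \<Rightarrow> ereal" where
  "game_objective \<mu> Pz Pdata M w lam dens G C D =
     eexpect (density \<mu> (\<lambda>x. ennreal (Pdata x))) (\<lambda>x. elog (D x))
     + (\<Sum>m=1..M. ereal (w m) * eexpect Pz (\<lambda>z. elog (1 - D (G m z))))
     - ereal lam * (\<Sum>m=1..M. ereal (w m) *
         eexpect (density \<mu> (\<lambda>x. ennreal (dens (G m) x))) (\<lambda>x. elog (C m x)))"

definition JSD_objective ::
  "'a measure \<Rightarrow> ('a \<Rightarrow> real) \<Rightarrow> nat \<Rightarrow> (nat \<Rightarrow> real) \<Rightarrow> real \<Rightarrow>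
   (('z \<Rightarrow> 'a) \<Rightarrow> 'a \<Rightarrow> real) \<Rightarrow> (nat \<Rightarrow> 'z \<Rightarrow> 'a) \<Rightarrow> real" where
  "JSD_objective \<mu> Pdata M w lam dens G =
     2 * JSD \<mu> Pdata (mixture M w (\<lambda>m. dens (G m))) - lam * gen_JSD \<mu> M w (\<lambda>m. dens (G m))"

end

theory Submission
  imports Defs
begin

text \<open>The discriminator and the classifier solve the same problem: given nonnegative densities
  \<open>a i\<close> with sum \<open>s\<close>, minimize the expected loss \<open>\<Sum>i. \<integral> a i * (- log (C i))\<close> over simplex-valued
  functions \<open>C\<close>. Gibbs' inequality holds pointwise in the extended nonnegative reals, so no
  integrability of the competitors is required; the minimizer is \<open>C i = a i / s\<close>, and the minimum
  is finite because \<open>a * log (s / a) \<le> s\<close>. Expanding the logarithms turns the two minima into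
  \<open>2 log 2 - 2 JSD\<close> and \<open>- JSD\<^sub>\<pi> - \<Sum>m. \<pi> m * log (\<pi> m)\<close>. Since the objective is a sum of a function of
  \<open>D\<close> and a function of \<open>C\<close>, the two optimizations decouple, and the value of the game is the
  generators' objective up to an additive constant.\<close>

section \<open>Extended-valued logarithmic losses\<close>

text \<open>The loss \<open>- log t\<close>, infinite for \<open>t \<le> 0\<close>. As
  \<open>e2ennreal\<close> cuts negative values to 0, it is the true \<open>- log t\<close> only for
  \<open>t \<le> 1\<close>. Values in \<open>ennreal\<close> let sums and integrals be exchanged
  without integrability conditions.\<close>

definition nlog :: "real \<Rightarrow> ennreal" where
  "nlog t = e2ennreal (- elog t)"

lemma nlog_pos: "0 < t \<Longrightarrow> nlog t = ennreal (- ln t)"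
  by (simp add: nlog_def elog_def ennreal.abs_eq)

lemma nlog_nonpos: "t \<le> 0 \<Longrightarrow> nlog t = top"
  by (simp add: nlog_def elog_def e2ennreal_infty)

lemma measurable_nlog [measurable]: "nlog \<in> borel_measurable borel"
  unfolding nlog_def elog_def by measurable

text \<open>The positive part vanishes because \<open>elog\<close> is nonpositive on \<open>{..1}\<close>.\<close>
lemma eexpect_elog:
  assumes "\<And>x. x \<in> space N \<Longrightarrow> f x \<le> 1"
  shows "eexpect N (\<lambda>x. elog (f x)) = - enn2ereal (\<integral>\<^sup>+x. nlog (f x) \<partial>N)"
proof -
  have "e2ennreal (elog (f x)) = 0" if "x \<in> space N" for x
    using assms[OF that] by (auto simp: elog_def ennreal_neg e2ennreal_neg)
  then have "(\<integral>\<^sup>+x. e2ennreal (elog (f x)) \<partial>N) = 0"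
    by (simp cong: nn_integral_cong)
  then show ?thesis
    by (simp add: eexpect_def nlog_def zero_ennreal.rep_eq)
qed

text \<open>Both summands are at most 0, so \<open>\<infinity> - \<infinity>\<close> cannot occur
  and the minus sign can be pulled out of a sum.\<close>

lemma uminus_enn2ereal_add: "- enn2ereal x + - enn2ereal y = - enn2ereal (x + y)"
  by (cases x; cases y) (auto simp: plus_ennreal.rep_eq enn2ereal_ennreal)

lemma sum_ereal_mult_uminus_enn2ereal:
  fixes b :: "'i \<Rightarrow> ennreal"
  assumes "\<And>i. i \<in> I \<Longrightarrow> 0 \<le> w i"
  shows "(\<Sum>i\<in>I. ereal (w i) * - enn2ereal (b i)) = - enn2ereal (\<Sum>i\<in>I. ennreal (w i) * b i)"
  using assms
proof (induction I rule: infinite_finite_induct)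
  case (insert i I)
  have "ereal (w i) * - enn2ereal (b i) = - enn2ereal (ennreal (w i) * b i)"
    using insert.prems by (simp add: times_ennreal.rep_eq enn2ereal_ennreal)
  with insert show ?case
    by (simp only: sum.insert uminus_enn2ereal_add insert_iff simp_thms)
qed (auto simp: zero_ennreal.rep_eq)

text \<open>With \<open>a\<close> the pair of data and model densities and \<open>C = (D, 1 - D)\<close> this is minus the
  discriminator part of the game; with \<open>a m = \<pi> m * P m\<close> it is the loss of the classifier.\<close>
definition cross_loss ::
  "'a measure \<Rightarrow> 'i set \<Rightarrow> ('i \<Rightarrow> 'a \<Rightarrow> real) \<Rightarrow> ('i \<Rightarrow> 'a \<Rightarrow> real) \<Rightarrow> ennreal" where
  "cross_loss \<mu> I a C = (\<Sum>i\<in>I. \<integral>\<^sup>+x. ennreal (a i x) * nlog (C i x) \<partial>\<mu>)"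

text \<open>Terms with \<open>a i x = 0\<close> vanish, including those where the quotient is \<open>0 / 0\<close>.\<close>
definition split_entropy :: "'a measure \<Rightarrow> 'i set \<Rightarrow> ('i \<Rightarrow> 'a \<Rightarrow> real) \<Rightarrow> real" where
  "split_entropy \<mu> I a = (\<Sum>i\<in>I. \<integral>x. a i x * - ln (a i x / (\<Sum>j\<in>I. a j x)) \<partial>\<mu>)"

section \<open>Gibbs' inequality and the minimal loss\<close>

text \<open>The upper bound is \<open>ln y \<le> y - 1\<close> at \<open>y = s / a\<close>. It makes
  \<open>s\<close> an integrable majorant of every entropy integrand below.\<close>

lemma mult_neg_ln_div_bounds:
  fixes a s :: real
  assumes "0 \<le> a" "a \<le> s"
  shows "0 \<le> a * - ln (a / s)" and "a * - ln (a / s) \<le> s"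
proof -
  show "0 \<le> a * - ln (a / s)"
    using assms by (cases "a = 0") (auto intro!: mult_nonneg_nonpos)
  show "a * - ln (a / s) \<le> s"
  proof (cases "a = 0")
    case False
    then have "0 < a" "0 < s" using assms by auto
    then have "- ln (a / s) = ln (s / a)" by (simp add: ln_div)
    also have "\<dots> \<le> s / a - 1" using \<open>0 < a\<close> \<open>0 < s\<close> by (intro ln_le_minus_one) simp
    finally have "a * - ln (a / s) \<le> a * (s / a - 1)"
      using \<open>0 < a\<close> by (intro mult_left_mono) auto
    also have "\<dots> = s - a" using \<open>0 < a\<close> by (simp add: field_simps)
    finally show ?thesis using \<open>0 < a\<close> by simp
  qed (use assms in simp)
qed

text \<open>If some \<open>c i\<close> vanishes where \<open>a i\<close> is positive, the right-hand
  side is infinite. Otherwise all terms are real and the tangent bound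
  \<open>ln y \<le> y - 1\<close> is applied class by class.\<close>

lemma gibbs_pointwise:
  fixes a c :: "'i \<Rightarrow> real"
  assumes "finite I" "\<And>i. i \<in> I \<Longrightarrow> 0 \<le> a i" "\<And>i. i \<in> I \<Longrightarrow> 0 \<le> c i" "(\<Sum>i\<in>I. c i) = 1"
  shows "ennreal (\<Sum>i\<in>I. a i * - ln (a i / (\<Sum>j\<in>I. a j))) \<le> (\<Sum>i\<in>I. ennreal (a i) * nlog (c i))"
proof (cases "\<exists>i\<in>I. 0 < a i \<and> c i = 0")
  case True
  then obtain i where i: "i \<in> I" "0 < a i" "c i = 0" by auto
  then have "ennreal (a i) * nlog (c i) = top"
    by (simp add: nlog_nonpos ennreal_mult_top)
  then have "(\<Sum>i\<in>I. ennreal (a i) * nlog (c i)) = top"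
    using i assms(1) by (subst sum.remove[of I i]) auto
  then show ?thesis by simp
next
  case False
  define s where "s = (\<Sum>j\<in>I. a j)"
  have term_eq: "ennreal (a i) * nlog (c i) = ennreal (a i * - ln (c i))"
    and term_nonneg: "0 \<le> a i * - ln (c i)" if "i \<in> I" for i
  proof -
    \<comment> \<open>With \<open>c i \<le> 1\<close> the number \<open>- ln (c i)\<close> is
      nonnegative, so \<open>ennreal\<close> truncates nothing; at \<open>c i = 0\<close> the
      convention \<open>ln 0 = 0\<close> applies.\<close>
    have "c i \<le> 1" using member_le_sum[of i I c] that assms by auto
    show "0 \<le> a i * - ln (c i)"
      using assms(2,3)[OF that] \<open>c i \<le> 1\<close> by (cases "c i = 0") (auto intro!: mult_nonneg_nonpos)
    show "ennreal (a i) * nlog (c i) = ennreal (a i * - ln (c i))"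
    proof (cases "a i = 0")
      case False
      then have "0 < a i" using assms(2)[OF that] by simp
      then have "0 < c i" using \<open>\<not> (\<exists>i\<in>I. _ i)\<close> that assms(3)[OF that] by fastforce
      with \<open>0 < a i\<close> \<open>c i \<le> 1\<close> show ?thesis
        by (simp add: nlog_pos ennreal_mult[symmetric])
    qed simp
  qed
  \<comment> \<open>The tangent bound at \<open>y = s * c i / a i\<close>. The corrections
    \<open>s * c i - a i\<close> add up to \<open>s - s = 0\<close> because the \<open>c i\<close>
    sum to 1.\<close>
  have "a i * - ln (a i / s) \<le> a i * - ln (c i) + (s * c i - a i)" if "i \<in> I" for i
  proof (cases "a i = 0")
    case True
    then show ?thesis using assms that by (simp add: s_def sum_nonneg)
  next
    case nz: False
    then have a: "0 < a i" using assms(2)[OF that] by simp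
    then have c: "0 < c i" using False that assms(3)[OF that] by fastforce
    have "a i \<le> s" unfolding s_def using that assms by (intro member_le_sum) auto
    then have s: "0 < s" using a by simp
    have "ln (s * c i / a i) \<le> s * c i / a i - 1"
      using a c s by (intro ln_le_minus_one) simp
    then have "a i * ln (s * c i / a i) \<le> a i * (s * c i / a i - 1)"
      using a by (intro mult_left_mono) auto
    also have "\<dots> = s * c i - a i" using a by (simp add: field_simps)
    finally show ?thesis using a c s by (simp add: ln_div ln_mult algebra_simps)
  qed
  then have "(\<Sum>i\<in>I. a i * - ln (a i / s)) \<le> (\<Sum>i\<in>I. a i * - ln (c i) + (s * c i - a i))"
    by (intro sum_mono) auto
  also have "\<dots> = (\<Sum>i\<in>I. a i * - ln (c i))"
    using assms(4) by (simp add: sum.distrib sum_subtractf sum_negf s_def flip: sum_distrib_left)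
  finally have "ennreal (\<Sum>i\<in>I. a i * - ln (a i / s)) \<le> ennreal (\<Sum>i\<in>I. a i * - ln (c i))"
    by (rule ennreal_leI)
  also have "\<dots> = (\<Sum>i\<in>I. ennreal (a i) * nlog (c i))"
    using term_nonneg by (subst sum_ennreal[symmetric]) (auto simp: term_eq)
  finally show ?thesis by (simp add: s_def)
qed

lemma integrable_mult_ln_div:
  fixes a s :: "'a \<Rightarrow> real"
  assumes "a \<in> borel_measurable \<mu>" "integrable \<mu> s" "\<And>x. x \<in> space \<mu> \<Longrightarrow> 0 \<le> a x \<and> a x \<le> s x"
  shows "integrable \<mu> (\<lambda>x. a x * - ln (a x / s x))"
proof (rule Bochner_Integration.integrable_bound[OF assms(2)])
  have [measurable]: "a \<in> borel_measurable \<mu>" "s \<in> borel_measurable \<mu>"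
    using assms by auto
  show "(\<lambda>x. a x * - ln (a x / s x)) \<in> borel_measurable \<mu>" by measurable
  show "AE x in \<mu>. norm (a x * - ln (a x / s x)) \<le> norm (s x)"
  proof (rule AE_I2)
    fix x assume "x \<in> space \<mu>"
    with assms(3) have "0 \<le> a x" "a x \<le> s x" by auto
    from mult_neg_ln_div_bounds[OF this]
    show "norm (a x * - ln (a x / s x)) \<le> norm (s x)" by simp
  qed
qed

context
  fixes \<mu> :: "'a measure" and I :: "'i set" and a :: "'i \<Rightarrow> 'a \<Rightarrow> real"
  assumes finite_I: "finite I"
    and integrable_a: "\<And>i. i \<in> I \<Longrightarrow> integrable \<mu> (a i)"
    and a_nonneg: "\<And>i x. i \<in> I \<Longrightarrow> x \<in> space \<mu> \<Longrightarrow> 0 \<le> a i x"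
begin

lemma le_sum_a: "i \<in> I \<Longrightarrow> x \<in> space \<mu> \<Longrightarrow> a i x \<le> (\<Sum>j\<in>I. a j x)"
  using finite_I a_nonneg by (intro member_le_sum) auto

lemma split_term_integrable:
  "i \<in> I \<Longrightarrow> integrable \<mu> (\<lambda>x. a i x * - ln (a i x / (\<Sum>j\<in>I. a j x)))"
  using integrable_a a_nonneg le_sum_a by (intro integrable_mult_ln_div) auto

lemma split_term_nonneg:
  "i \<in> I \<Longrightarrow> x \<in> space \<mu> \<Longrightarrow> 0 \<le> a i x * - ln (a i x / (\<Sum>j\<in>I. a j x))"
  using a_nonneg le_sum_a by (intro mult_neg_ln_div_bounds) auto

lemma split_entropy_nonneg: "0 \<le> split_entropy \<mu> I a"
  unfolding split_entropy_def
  by (intro sum_nonneg Bochner_Integration.integral_nonneg split_term_nonneg)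

lemma ennreal_split_entropy:
  "ennreal (split_entropy \<mu> I a) =
   (\<Sum>i\<in>I. \<integral>\<^sup>+x. ennreal (a i x * - ln (a i x / (\<Sum>j\<in>I. a j x))) \<partial>\<mu>)"
proof -
  have "ennreal (split_entropy \<mu> I a) =
      (\<Sum>i\<in>I. ennreal (\<integral>x. a i x * - ln (a i x / (\<Sum>j\<in>I. a j x)) \<partial>\<mu>))"
    unfolding split_entropy_def
    by (intro sum_ennreal[symmetric] Bochner_Integration.integral_nonneg split_term_nonneg)
  also have "\<dots> = (\<Sum>i\<in>I. \<integral>\<^sup>+x. ennreal (a i x * - ln (a i x / (\<Sum>j\<in>I. a j x))) \<partial>\<mu>)"
    by (intro sum.cong nn_integral_eq_integral[symmetric] split_term_integrable AE_I2
        split_term_nonneg) auto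
  finally show ?thesis .
qed

text \<open>\<open>gibbs_pointwise\<close> under the integral. Sum and integral commute in
  \<open>ennreal\<close>, so competitors of infinite loss are covered as well.\<close>

lemma split_entropy_le_cross_loss:
  assumes "\<And>i. i \<in> I \<Longrightarrow> C i \<in> borel_measurable \<mu>"
    and "\<And>i x. i \<in> I \<Longrightarrow> x \<in> space \<mu> \<Longrightarrow> 0 \<le> C i x"
    and "\<And>x. x \<in> space \<mu> \<Longrightarrow> (\<Sum>i\<in>I. C i x) = 1"
  shows "ennreal (split_entropy \<mu> I a) \<le> cross_loss \<mu> I a C"
proof -
  note [measurable] = assms(1) borel_measurable_integrable[OF integrable_a]
    borel_measurable_integrable[OF split_term_integrable]
  have "ennreal (split_entropy \<mu> I a) =
      (\<integral>\<^sup>+x. (\<Sum>i\<in>I. ennreal (a i x * - ln (a i x / (\<Sum>j\<in>I. a j x)))) \<partial>\<mu>)"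
    unfolding ennreal_split_entropy
    by (intro nn_integral_sum[symmetric]) measurable
  also have "\<dots> \<le> (\<integral>\<^sup>+x. (\<Sum>i\<in>I. ennreal (a i x) * nlog (C i x)) \<partial>\<mu>)"
    using gibbs_pointwise[OF finite_I a_nonneg assms(2,3)] split_term_nonneg
    by (intro nn_integral_mono) (simp add: sum_ennreal)
  also have "\<dots> = cross_loss \<mu> I a C"
    unfolding cross_loss_def by (intro nn_integral_sum) measurable
  finally show ?thesis .
qed

text \<open>The integrands agree pointwise. Where the total density is 0, every \<open>a i x\<close>
  is 0 by nonnegativity, so \<open>C\<close> may take any value there.\<close>

lemma cross_loss_optimal:
  assumes "\<And>i x. i \<in> I \<Longrightarrow> x \<in> space \<mu> \<Longrightarrow> (\<Sum>j\<in>I. a j x) \<noteq> 0 \<Longrightarrow>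
             C i x = a i x / (\<Sum>j\<in>I. a j x)"
  shows "cross_loss \<mu> I a C = ennreal (split_entropy \<mu> I a)"
  unfolding cross_loss_def ennreal_split_entropy
proof (intro sum.cong nn_integral_cong refl)
  fix i x assume i: "i \<in> I" and x: "x \<in> space \<mu>"
  show "ennreal (a i x) * nlog (C i x) = ennreal (a i x * - ln (a i x / (\<Sum>j\<in>I. a j x)))"
  proof (cases "a i x = 0")
    case False
    then have pos: "0 < a i x" using a_nonneg[OF i x] by simp
    then have "0 < (\<Sum>j\<in>I. a j x)" using le_sum_a[OF i x] by linarith
    with pos assms[OF i x] show ?thesis
      by (simp add: nlog_pos ennreal_mult'[symmetric])
  qed simp
qed

end

section \<open>Divergences expressed by split entropies\<close>

lemma prob_densityD:
  assumes "prob_density \<mu> P"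
  shows "P \<in> borel_measurable \<mu>" "\<And>x. x \<in> space \<mu> \<Longrightarrow> 0 \<le> P x" "integrable \<mu> P" "(\<integral>x. P x \<partial>\<mu>) = 1"
proof -
  show m: "P \<in> borel_measurable \<mu>" and nn: "\<And>x. x \<in> space \<mu> \<Longrightarrow> 0 \<le> P x"
    using assms by (auto simp: prob_density_def)
  have one: "(\<integral>\<^sup>+x. ennreal (P x) \<partial>\<mu>) = 1" using assms by (simp add: prob_density_def)
  show "integrable \<mu> P"
    using m nn one by (intro integrableI_nonneg) auto
  show "(\<integral>x. P x \<partial>\<mu>) = 1"
    using m nn one by (subst integral_eq_nn_integral) auto
qed

text \<open>Since \<open>ln (w * P / Q) = ln w + ln (P / Q)\<close> and \<open>P\<close> has mass 1,
  moving the weight into the logarithm costs exactly \<open>w * ln w\<close>. Both sides are 0 at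
  \<open>w = 0\<close>, whatever value \<open>KL\<close> has there.\<close>

lemma KL_scaled:
  assumes "sigma_finite_measure \<mu>" "prob_density \<mu> P" "integrable \<mu> Q" "0 \<le> w"
    and le: "\<And>x. x \<in> space \<mu> \<Longrightarrow> w * P x \<le> Q x" and Q: "\<And>x. x \<in> space \<mu> \<Longrightarrow> 0 \<le> Q x"
  shows "w * KL \<mu> P Q = - (\<integral>x. w * P x * - ln (w * P x / Q x) \<partial>\<mu>) - w * ln w"
proof (cases "w = 0")
  case False
  then have w: "0 < w" using assms by simp
  note P = prob_densityD[OF assms(2)]
  interpret sigma_finite_measure \<mu> by fact
  \<comment> \<open>Absolute continuity, from the domination \<open>w * P x \<le> Q x\<close> with
    \<open>w > 0\<close>.\<close>
  have zero: "P x = 0" if "x \<in> space \<mu>" "Q x = 0" for x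
    using le[OF that(1)] that P(2)[OF that(1)] w by (simp add: mult_le_0_iff)
  have "KL \<mu> P Q = (\<integral>x. P x * log (exp 1) (P x / Q x) \<partial>\<mu>)"
    unfolding KL_def using P assms(3) zero Q
    by (intro KL_density_density) auto
  also have "w * \<dots> = (\<integral>x. - (w * P x * - ln (w * P x / Q x)) - w * ln w * P x \<partial>\<mu>)"
  proof (subst integral_mult_right_zero[symmetric], intro Bochner_Integration.integral_cong refl)
    fix x assume x: "x \<in> space \<mu>"
    show "w * (P x * log (exp 1) (P x / Q x)) =
        - (w * P x * - ln (w * P x / Q x)) - w * ln w * P x"
    proof (cases "P x = 0")
      case False
      then have "0 < P x" "0 < Q x" using P(2)[OF x] Q[OF x] zero[OF x] by force+
      then show ?thesis using w by (simp add: log_def ln_mult ln_div algebra_simps)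
    qed simp
  qed
  also have "\<dots> = - (\<integral>x. w * P x * - ln (w * P x / Q x) \<partial>\<mu>) - w * ln w"
  proof (subst Bochner_Integration.integral_diff)
    show "integrable \<mu> (\<lambda>x. - (w * P x * - ln (w * P x / Q x)))"
      using assms P by (intro Bochner_Integration.integrable_minus integrable_mult_ln_div) auto
  qed (use P in auto)
  finally show ?thesis .
qed simp

text \<open>\<open>KL_scaled\<close> with weight \<open>1/2\<close> for each density against the
  midpoint; the two terms \<open>- 1/2 * ln (1/2)\<close> add up to \<open>ln 2\<close>, which is
  then doubled.\<close>

lemma JSD_eq_split_entropy:
  assumes "sigma_finite_measure \<mu>" "prob_density \<mu> P" "prob_density \<mu> Q"
  shows "2 * JSD \<mu> P Q = 2 * ln 2 - split_entropy \<mu> UNIV (case_bool P Q)"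
proof -
  note P = prob_densityD[OF assms(2)] and Q = prob_densityD[OF assms(3)]
  have "1/2 * KL \<mu> P (\<lambda>x. (P x + Q x) / 2) =
      - (\<integral>x. 1/2 * P x * - ln (1/2 * P x / ((P x + Q x) / 2)) \<partial>\<mu>) - 1/2 * ln (1/2)"
    using assms P Q by (intro KL_scaled) auto
  moreover have "1/2 * KL \<mu> Q (\<lambda>x. (P x + Q x) / 2) =
      - (\<integral>x. 1/2 * Q x * - ln (1/2 * Q x / ((P x + Q x) / 2)) \<partial>\<mu>) - 1/2 * ln (1/2)"
    using assms P Q by (intro KL_scaled) auto
  \<comment> \<open>The halves cancel inside the logarithm, turning the midpoint into the total
    \<open>P + Q\<close>; the outer half is absorbed by the factor in
    \<open>2 * JSD\<close>.\<close>
  moreover have "(\<integral>x. 1/2 * f x * - ln (1/2 * f x / (g x / 2)) \<partial>\<mu>) = 1/2 * (\<integral>x. f x * - ln (f x / g x) \<partial>\<mu>)"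
    for f g :: "'a \<Rightarrow> real"
    by (subst integral_mult_right_zero[symmetric]) (simp add: mult.assoc)
  moreover have "ln (1/2) = - ln (2::real)" by (simp add: ln_div)
  ultimately show ?thesis
    by (simp add: JSD_def split_entropy_def UNIV_bool algebra_simps)
qed

text \<open>\<open>KL_scaled\<close> for each class, with the mixture as total density. The leftover
  terms form the negative entropy of the weights, which does not depend on \<open>P\<close>.\<close>

lemma gen_JSD_eq_split_entropy:
  assumes "sigma_finite_measure \<mu>"
    and P: "\<And>m. m \<in> {1..M} \<Longrightarrow> prob_density \<mu> (P m)" and w: "\<And>m. m \<in> {1..M} \<Longrightarrow> 0 \<le> w m"
  shows "gen_JSD \<mu> M w P =
    - split_entropy \<mu> {1..M} (\<lambda>m x. w m * P m x) - (\<Sum>m=1..M. w m * ln (w m))"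
proof -
  note Pd = prob_densityD[OF P]
  have "w m * KL \<mu> (P m) (mixture M w P) =
      - (\<integral>x. w m * P m x * - ln (w m * P m x / mixture M w P x) \<partial>\<mu>) - w m * ln (w m)"
    if m: "m \<in> {1..M}" for m
  proof (rule KL_scaled[OF assms(1) P[OF m] _ w[OF m]])
    show "integrable \<mu> (mixture M w P)"
      unfolding mixture_def using Pd by auto
    fix x assume x: "x \<in> space \<mu>"
    have nn: "0 \<le> w j * P j x" if "j \<in> {1..M}" for j
      using w[OF that] Pd(2)[OF that x] by simp
    show "w m * P m x \<le> mixture M w P x"
      unfolding mixture_def using m nn
      by (intro member_le_sum[where f = "\<lambda>j. w j * P j x"]) auto
    show "0 \<le> mixture M w P x"
      unfolding mixture_def using nn by (intro sum_nonneg)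
  qed
  then show ?thesis
    unfolding gen_JSD_def split_entropy_def mixture_def
    by (simp add: sum_subtractf sum_negf)
qed

lemma prob_density_mixture:
  assumes P: "\<And>m. m \<in> {1..M} \<Longrightarrow> prob_density \<mu> (P m)" and w: "\<And>m. m \<in> {1..M} \<Longrightarrow> 0 \<le> w m"
    and "(\<Sum>m=1..M. w m) = 1"
  shows "prob_density \<mu> (mixture M w P)"
proof -
  note Pd = prob_densityD[OF P]
  have int: "integrable \<mu> (mixture M w P)" unfolding mixture_def using Pd by auto
  have nn: "0 \<le> mixture M w P x" if "x \<in> space \<mu>" for x
    unfolding mixture_def using w Pd that by (auto intro!: sum_nonneg)
  have "(\<integral>x. mixture M w P x \<partial>\<mu>) = 1"
    unfolding mixture_def using Pd assms(3) by (subst Bochner_Integration.integral_sum) auto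
  then have "(\<integral>\<^sup>+x. ennreal (mixture M w P x) \<partial>\<mu>) = 1"
    using nn_integral_eq_integral[OF int AE_I2[OF nn]] by simp
  with int nn show ?thesis by (auto simp: prob_density_def)
qed

section \<open>The game objective as a sum of two losses\<close>

lemma discriminators_iff:
  "D \<in> discriminators \<mu> \<longleftrightarrow> D \<in> borel_measurable \<mu> \<and> (\<forall>x\<in>space \<mu>. 0 \<le> D x \<and> D x \<le> 1)"
  by (simp add: discriminators_def)

lemma classifiersD:
  assumes "C \<in> classifiers \<mu> M"
  shows "\<And>m. m \<in> {1..M} \<Longrightarrow> C m \<in> borel_measurable \<mu>"
    and "\<And>m x. m \<in> {1..M} \<Longrightarrow> x \<in> space \<mu> \<Longrightarrow> 0 \<le> C m x"
    and "\<And>x. x \<in> space \<mu> \<Longrightarrow> (\<Sum>m=1..M. C m x) = 1"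
  using assms by (auto simp: classifiers_def)

text \<open>Every logarithm is taken of a number at most 1, so every expectation is minus an
  \<open>ennreal\<close> integral. The classifier term is subtracted in the game and therefore
  reappears as \<open>lam\<close> times a loss.\<close>

lemma game_objective_eq_cross_loss:
  assumes "prob_density \<mu> Pdata"
    and w: "\<And>m. m \<in> {1..M} \<Longrightarrow> 0 \<le> w m"
    and dens: "\<And>m. m \<in> {1..M} \<Longrightarrow> prob_density \<mu> (dens (G m))"
    and distr: "\<And>m. m \<in> {1..M} \<Longrightarrow> distributed Pz \<mu> (G m) (\<lambda>x. ennreal (dens (G m) x))"
    and D: "D \<in> discriminators \<mu>" and C: "C \<in> classifiers \<mu> M"
  shows "game_objective \<mu> Pz Pdata M w lam dens G C D =
    - enn2ereal (cross_loss \<mu> UNIV (case_bool Pdata (mixture M w (\<lambda>m. dens (G m)))) (case_bool D (\<lambda>x. 1 - D x)))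
    + ereal lam * enn2ereal (cross_loss \<mu> {1..M} (\<lambda>m x. w m * dens (G m) x) C)"
proof -
  define q where "q = mixture M w (\<lambda>m. dens (G m))"
  note P = prob_densityD[OF assms(1)] and d = prob_densityD[OF dens]
  have D_meas [measurable]: "D \<in> borel_measurable \<mu>" and D01: "\<And>x. x \<in> space \<mu> \<Longrightarrow> 0 \<le> D x \<and> D x \<le> 1"
    using D by (auto simp: discriminators_iff)
  have nlog_meas: "(\<lambda>x. nlog (1 - D x)) \<in> borel_measurable \<mu>" by measurable
  have q_eq: "(\<Sum>m=1..M. ennreal (w m * dens (G m) x)) = ennreal (q x)" if "x \<in> space \<mu>" for x
    unfolding q_def mixture_def using w d(2) that by (intro sum_ennreal mult_nonneg_nonneg) auto
  have real_term: "eexpect (density \<mu> (\<lambda>x. ennreal (Pdata x))) (\<lambda>x. elog (D x)) =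
      - enn2ereal (\<integral>\<^sup>+x. ennreal (Pdata x) * nlog (D x) \<partial>\<mu>)"
    using P(1) D01 by (subst eexpect_elog) (auto simp: nn_integral_density)
  \<comment> \<open>Each noise integral is pushed forward along \<open>G m\<close> to an integral
    against \<open>dens (G m)\<close>; the weights and the sum then move inside and leave one
    integral against the mixture \<open>q\<close>.\<close>
  have "(\<Sum>m=1..M. ereal (w m) * eexpect Pz (\<lambda>z. elog (1 - D (G m z)))) =
      (\<Sum>m=1..M. ereal (w m) * - enn2ereal (\<integral>\<^sup>+x. ennreal (dens (G m) x) * nlog (1 - D x) \<partial>\<mu>))"
  proof (intro sum.cong refl arg_cong2[where f = "(*)"])
    fix m assume m: "m \<in> {1..M}"
    have "G m z \<in> space \<mu>" if "z \<in> space Pz" for z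
      using distributed_measurable[OF distr[OF m]] that by (rule measurable_space)
    then have "eexpect Pz (\<lambda>z. elog (1 - D (G m z))) = - enn2ereal (\<integral>\<^sup>+z. nlog (1 - D (G m z)) \<partial>Pz)"
      using D01 by (intro eexpect_elog) auto
    then show "eexpect Pz (\<lambda>z. elog (1 - D (G m z))) =
        - enn2ereal (\<integral>\<^sup>+x. ennreal (dens (G m) x) * nlog (1 - D x) \<partial>\<mu>)"
      by (subst distributed_nn_integral[OF distr[OF m], of "\<lambda>x. nlog (1 - D x)"]) auto
  qed
  also have "\<dots> = - enn2ereal (\<Sum>m=1..M. ennreal (w m) * (\<integral>\<^sup>+x. ennreal (dens (G m) x) * nlog (1 - D x) \<partial>\<mu>))"
    using w by (rule sum_ereal_mult_uminus_enn2ereal)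
  also have "(\<Sum>m=1..M. ennreal (w m) * (\<integral>\<^sup>+x. ennreal (dens (G m) x) * nlog (1 - D x) \<partial>\<mu>)) =
      (\<Sum>m=1..M. \<integral>\<^sup>+x. ennreal (w m * dens (G m) x) * nlog (1 - D x) \<partial>\<mu>)"
    using w d nlog_meas by (intro sum.cong refl) (simp add: nn_integral_cmult[symmetric] ennreal_mult' mult.assoc)
  also have "\<dots> = (\<integral>\<^sup>+x. (\<Sum>m=1..M. ennreal (w m * dens (G m) x) * nlog (1 - D x)) \<partial>\<mu>)"
    using d nlog_meas by (intro nn_integral_sum[symmetric]) auto
  also have "\<dots> = (\<integral>\<^sup>+x. ennreal (q x) * nlog (1 - D x) \<partial>\<mu>)"
    by (intro nn_integral_cong) (simp only: q_eq flip: sum_distrib_right)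
  finally have model_term: "(\<Sum>m=1..M. ereal (w m) * eexpect Pz (\<lambda>z. elog (1 - D (G m z)))) =
      - enn2ereal (\<integral>\<^sup>+x. ennreal (q x) * nlog (1 - D x) \<partial>\<mu>)" .
  have "(\<Sum>m=1..M. ereal (w m) * eexpect (density \<mu> (\<lambda>x. ennreal (dens (G m) x))) (\<lambda>x. elog (C m x))) =
      (\<Sum>m=1..M. ereal (w m) * - enn2ereal (\<integral>\<^sup>+x. ennreal (dens (G m) x) * nlog (C m x) \<partial>\<mu>))"
  proof (intro sum.cong refl arg_cong2[where f = "(*)"])
    fix m assume m: "m \<in> {1..M}"
    have "C m x \<le> 1" if "x \<in> space \<mu>" for x
      using member_le_sum[of m "{1..M}" "\<lambda>m. C m x"] m classifiersD(2,3)[OF C] that by auto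
    moreover have "C m \<in> borel_measurable \<mu>" using classifiersD(1)[OF C m] .
    ultimately show "eexpect (density \<mu> (\<lambda>x. ennreal (dens (G m) x))) (\<lambda>x. elog (C m x)) =
        - enn2ereal (\<integral>\<^sup>+x. ennreal (dens (G m) x) * nlog (C m x) \<partial>\<mu>)"
      using d(1)[OF m] by (subst eexpect_elog) (auto simp: nn_integral_density)
  qed
  also have "\<dots> = - enn2ereal (\<Sum>m=1..M. ennreal (w m) * (\<integral>\<^sup>+x. ennreal (dens (G m) x) * nlog (C m x) \<partial>\<mu>))"
    using w by (rule sum_ereal_mult_uminus_enn2ereal)
  also have "(\<Sum>m=1..M. ennreal (w m) * (\<integral>\<^sup>+x. ennreal (dens (G m) x) * nlog (C m x) \<partial>\<mu>)) =
      cross_loss \<mu> {1..M} (\<lambda>m x. w m * dens (G m) x) C"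
    unfolding cross_loss_def using w d classifiersD(1)[OF C]
    by (intro sum.cong refl) (simp add: nn_integral_cmult[symmetric] ennreal_mult' mult.assoc)
  finally have class_term: "(\<Sum>m=1..M. ereal (w m) * eexpect (density \<mu> (\<lambda>x. ennreal (dens (G m) x))) (\<lambda>x. elog (C m x))) =
      - enn2ereal (cross_loss \<mu> {1..M} (\<lambda>m x. w m * dens (G m) x) C)" .
  show ?thesis
    unfolding game_objective_def real_term model_term class_term uminus_enn2ereal_add
    by (simp add: cross_loss_def UNIV_bool q_def minus_ereal_def add.commute)
qed

section \<open>Optimal discriminator and classifier\<close>

lemma bayes_discriminator:
  assumes "prob_density \<mu> P" "prob_density \<mu> Q"
  shows "\<exists>D\<in>discriminators \<mu>. cross_loss \<mu> UNIV (case_bool P Q) (case_bool D (\<lambda>x. 1 - D x)) =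
    ennreal (split_entropy \<mu> UNIV (case_bool P Q))"
proof
  note P = prob_densityD[OF assms(1)] and Q = prob_densityD[OF assms(2)]
  \<comment> \<open>The posterior probability of a sample being real under equal priors. Where both
    densities vanish, \<open>0 / 0 = 0\<close> still lies in the unit interval.\<close>
  let ?D = "\<lambda>x. P x / (P x + Q x)"
  have eq: "1 - ?D x = Q x / (P x + Q x)" if "P x + Q x \<noteq> 0" for x
    using that by (simp add: divide_simps)
  show "?D \<in> discriminators \<mu>"
    using P Q by (auto simp: discriminators_iff divide_le_eq_1 less_le)
  show "cross_loss \<mu> UNIV (case_bool P Q) (case_bool ?D (\<lambda>x. 1 - ?D x)) =
    ennreal (split_entropy \<mu> UNIV (case_bool P Q))"
    using P Q eq by (intro cross_loss_optimal) (auto simp: UNIV_bool add.commute split: bool.splits)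
qed

text \<open>The minimizer is the posterior probability of generator \<open>m\<close> given the
  sample, with prior \<open>w\<close>.\<close>

lemma bayes_classifier:
  assumes P: "\<And>m. m \<in> {1..M} \<Longrightarrow> prob_density \<mu> (P m)" and w: "\<And>m. m \<in> {1..M} \<Longrightarrow> 0 \<le> w m"
    and "(\<Sum>m=1..M. w m) = 1"
  shows "\<exists>C\<in>classifiers \<mu> M. cross_loss \<mu> {1..M} (\<lambda>m x. w m * P m x) C =
    ennreal (split_entropy \<mu> {1..M} (\<lambda>m x. w m * P m x))"
proof
  note Pd = prob_densityD[OF P]
  let ?s = "\<lambda>x. \<Sum>j=1..M. w j * P j x"
  \<comment> \<open>Where the mixture vanishes the values are irrelevant to the loss but must still sum to 1.\<close>
  let ?C = "\<lambda>m x. if ?s x = 0 then w m else w m * P m x / ?s x"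
  have [measurable]: "?s \<in> borel_measurable \<mu>"
    using Pd(1) by (intro borel_measurable_sum) auto
  have "?C m \<in> borel_measurable \<mu>" if "m \<in> {1..M}" for m
    using Pd(1)[OF that] by measurable
  moreover have "0 \<le> ?C m x" if "m \<in> {1..M}" "x \<in> space \<mu>" for m x
    using Pd(2) w that by (auto intro!: divide_nonneg_nonneg sum_nonneg)
  moreover have "(\<Sum>m=1..M. ?C m x) = 1" for x
    using assms(3) by (cases "?s x = 0") (simp_all flip: sum_divide_distrib)
  ultimately show "?C \<in> classifiers \<mu> M"
    unfolding classifiers_def by blast
  show "cross_loss \<mu> {1..M} (\<lambda>m x. w m * P m x) ?C =
    ennreal (split_entropy \<mu> {1..M} (\<lambda>m x. w m * P m x))"
    using Pd w by (intro cross_loss_optimal) auto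
qed

section \<open>Separable games and partial minimization\<close>

context
  fixes v :: "'c \<Rightarrow> 'd \<Rightarrow> ereal" and U :: "'d \<Rightarrow> ereal" and L :: "'c \<Rightarrow> ereal"
    and u l :: real and \<C> :: "'c set" and \<D> :: "'d set"
  assumes v_eq: "\<And>c d. c \<in> \<C> \<Longrightarrow> d \<in> \<D> \<Longrightarrow> v c d = U d + L c"
    and U_le: "\<And>d. d \<in> \<D> \<Longrightarrow> U d \<le> ereal u" and U_max: "\<exists>d\<in>\<D>. U d = ereal u"
    and L_ge: "\<And>c. c \<in> \<C> \<Longrightarrow> ereal l \<le> L c" and L_min: "\<exists>c\<in>\<C>. L c = ereal l"
begin

text \<open>Optimizers need not be unique, yet the value is: \<open>d\<close> is compared with a
  maximizer of \<open>U\<close>, \<open>c\<close> with a minimizer of \<open>L\<close>. Infinite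
  values of \<open>U d\<close> or \<open>L c\<close> contradict one of the two comparisons or the
  bounds, and finite ones can be cancelled.\<close>

lemma separable_equilibrium_value:
  assumes "is_arg_max (v c) (\<lambda>d. d \<in> \<D>) d" "is_arg_min (\<lambda>c. v c d) (\<lambda>c. c \<in> \<C>) c"
  shows "v c d = ereal (u + l)"
proof -
  from U_max L_min obtain d0 c0 where d0: "d0 \<in> \<D>" "U d0 = ereal u" and c0: "c0 \<in> \<C>" "L c0 = ereal l"
    by auto
  have d: "d \<in> \<D>" "\<not> v c d < v c d0" and c: "c \<in> \<C>" "\<not> v c0 d < v c d"
    using assms d0 c0 by (auto simp: is_arg_max_def is_arg_min_def)
  have vs: "v c d = U d + L c" "v c d0 = ereal u + L c" "v c0 d = U d + ereal l"
    using v_eq c d c0 d0 by auto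
  \<comment> \<open>If \<open>L c = \<infinity>\<close>, every \<open>d\<close> is a maximizer, but then \<open>c\<close> is beaten by \<open>c0\<close>.\<close>
  from c(2) d(2) U_le[OF d(1)] L_ge[OF c(1)] show ?thesis
    unfolding vs by (cases "U d"; cases "L c") auto
qed

text \<open>One maximizer of \<open>U\<close> attains the supremum for every \<open>c\<close>,
  including those with \<open>L c = \<infinity>\<close>.\<close>

lemma separable_SUP_value:
  assumes "c \<in> \<C>"
  shows "(SUP d\<in>\<D>. v c d) = ereal u + L c"
proof (rule antisym)
  show "(SUP d\<in>\<D>. v c d) \<le> ereal u + L c"
    using assms v_eq U_le by (auto intro!: SUP_least add_right_mono)
  from U_max obtain d0 where "d0 \<in> \<D>" "U d0 = ereal u" by auto
  with assms v_eq show "ereal u + L c \<le> (SUP d\<in>\<D>. v c d)"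
    by (auto intro!: SUP_upper2)
qed

end

text \<open>For fixed \<open>g\<close> the minimum of \<open>F g\<close> over \<open>c\<close> is
  \<open>J g + k\<close> and is attained, so joint minimization reduces to minimizing
  \<open>J\<close>. Attainment bounds \<open>J\<close> at a joint minimizer and supplies the missing
  \<open>c\<close> in the converse.\<close>

lemma joint_arg_min_iff:
  fixes F :: "'g \<Rightarrow> 'c \<Rightarrow> ereal" and J :: "'g \<Rightarrow> real"
  assumes ge: "\<And>g c. g \<in> \<G> \<Longrightarrow> c \<in> \<C> \<Longrightarrow> ereal (J g + k) \<le> F g c"
    and attained: "\<And>g. g \<in> \<G> \<Longrightarrow> \<exists>c\<in>\<C>. F g c = ereal (J g + k)"
  shows "(\<exists>c. is_arg_min (\<lambda>(g, c). F g c) (\<lambda>(g, c). g \<in> \<G> \<and> c \<in> \<C>) (g, c)) \<longleftrightarrow>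
         is_arg_min J (\<lambda>g. g \<in> \<G>) g"
proof
  assume "\<exists>c. is_arg_min (\<lambda>(g, c). F g c) (\<lambda>(g, c). g \<in> \<G> \<and> c \<in> \<C>) (g, c)"
  then obtain c where g: "g \<in> \<G>" "c \<in> \<C>"
    and min: "\<And>g' c'. g' \<in> \<G> \<Longrightarrow> c' \<in> \<C> \<Longrightarrow> F g c \<le> F g' c'"
    by (auto simp: is_arg_min_linorder)
  have "J g \<le> J g'" if g': "g' \<in> \<G>" for g'
  proof -
    obtain c' where "c' \<in> \<C>" "F g' c' = ereal (J g' + k)" using attained[OF g'] by auto
    with min[OF g'] ge[OF g] have "ereal (J g + k) \<le> ereal (J g' + k)"
      by (metis order_trans)
    then show ?thesis by simp
  qed
  with g show "is_arg_min J (\<lambda>g. g \<in> \<G>) g" by (simp add: is_arg_min_linorder)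
next
  assume "is_arg_min J (\<lambda>g. g \<in> \<G>) g"
  then have g: "g \<in> \<G>" and min: "\<And>g'. g' \<in> \<G> \<Longrightarrow> J g \<le> J g'"
    by (auto simp: is_arg_min_linorder)
  obtain c where c: "c \<in> \<C>" "F g c = ereal (J g + k)" using attained[OF g] by auto
  have "F g c \<le> F g' c'" if "g' \<in> \<G>" "c' \<in> \<C>" for g' c'
    using ge[OF that] min[OF that(1)] by (intro order_trans[OF _ ge[OF that]]) (simp add: c)
  with g c show "\<exists>c. is_arg_min (\<lambda>(g, c). F g c) (\<lambda>(g, c). g \<in> \<G> \<and> c \<in> \<C>) (g, c)"
    by (auto simp: is_arg_min_linorder)
qed

section \<open>Optimal generators of the game\<close>

theorem proposition2:
  fixes \<mu> :: "'a measure" and Pz :: "'z measure"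
    and Pdata :: "'a \<Rightarrow> real" and M :: nat and w :: "nat \<Rightarrow> real" and lam :: real
    and \<G> :: "(nat \<Rightarrow> 'z \<Rightarrow> 'a) set" and dens :: "('z \<Rightarrow> 'a) \<Rightarrow> 'a \<Rightarrow> real"
  defines "V \<equiv> game_objective \<mu> Pz Pdata M w lam dens"
    and "J \<equiv> JSD_objective \<mu> Pdata M w lam dens"
  assumes "sigma_finite_measure \<mu>" and "prob_space Pz"
    and "prob_density \<mu> Pdata"
    and "\<forall>m\<in>{1..M}. 0 \<le> w m" and "(\<Sum>m=1..M. w m) = 1"
    and "0 < lam"
    and "\<And>G m. G \<in> \<G> \<Longrightarrow> m \<in> {1..M} \<Longrightarrow>
           prob_density \<mu> (dens (G m)) \<and> distributed Pz \<mu> (G m) (\<lambda>x. ennreal (dens (G m) x))"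
  shows
    "(\<forall>Dopt Copt.
        (\<forall>G\<in>\<G>. is_arg_max (\<lambda>D. V G (Copt G) D) (\<lambda>D. D \<in> discriminators \<mu>) (Dopt G) \<and>
                is_arg_min (\<lambda>C. V G C (Dopt G)) (\<lambda>C. C \<in> classifiers \<mu> M) (Copt G)) \<longrightarrow>
        (\<exists>c::real. \<forall>G\<in>\<G>. V G (Copt G) (Dopt G) = ereal (J G + c)) \<and>
        (\<forall>G. is_arg_min (\<lambda>G. V G (Copt G) (Dopt G)) (\<lambda>G. G \<in> \<G>) G \<longleftrightarrow>
             is_arg_min J (\<lambda>G. G \<in> \<G>) G)) \<and>
     (\<forall>G. (\<exists>C. is_arg_min (\<lambda>(G, C). SUP D\<in>discriminators \<mu>. V G C D)
                 (\<lambda>(G, C). G \<in> \<G> \<and> C \<in> classifiers \<mu> M) (G, C)) \<longleftrightarrow>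
          is_arg_min J (\<lambda>G. G \<in> \<G>) G)"
proof -
  note sf = assms(3) and Pdata = assms(5) and w1 = assms(7) and lam = assms(8)
  have w: "\<And>m. m \<in> {1..M} \<Longrightarrow> 0 \<le> w m" using assms(6) by auto
  have dens: "prob_density \<mu> (dens (G m))"
    and distr: "distributed Pz \<mu> (G m) (\<lambda>x. ennreal (dens (G m) x))"
    if "G \<in> \<G>" "m \<in> {1..M}" for G m
    using assms(9)[OF that] by auto
  \<comment> \<open>For given generators, \<open>U\<close> and \<open>L\<close> are the
    discriminator and classifier parts of the game, \<open>u\<close> and \<open>l\<close> their
    optimal values.\<close>
  define a where "a G = case_bool Pdata (mixture M w (\<lambda>m. dens (G m)))" for G
  define b where "b G m x = w m * dens (G m) x" for G m x
  define U where "U G D = - enn2ereal (cross_loss \<mu> UNIV (a G) (case_bool D (\<lambda>x. 1 - D x)))" for G D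
  define L where "L G C = ereal lam * enn2ereal (cross_loss \<mu> {1..M} (b G) C)" for G C
  define u where "u G = - split_entropy \<mu> UNIV (a G)" for G
  define l where "l G = lam * split_entropy \<mu> {1..M} (b G)" for G
  \<comment> \<open>The constants left over from the two divergence identities, with the signs they
    have in \<open>u G + l G\<close>; they are the same for all generators.\<close>
  define k where "k = - 2 * ln 2 - lam * (\<Sum>m=1..M. w m * ln (w m))"
  have mix: "prob_density \<mu> (mixture M w (\<lambda>m. dens (G m)))" if "G \<in> \<G>" for G
    using dens[OF that] w w1 by (rule prob_density_mixture)
  have V_eq: "V G C D = U G D + L G C"
    if "G \<in> \<G>" "C \<in> classifiers \<mu> M" "D \<in> discriminators \<mu>" for G C D
    unfolding V_def U_def L_def a_def b_def
    by (rule game_objective_eq_cross_loss) (use Pdata w dens distr that in auto)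
  have a_props: "integrable \<mu> (a G i)" "x \<in> space \<mu> \<Longrightarrow> 0 \<le> a G i x" if "G \<in> \<G>" for G i x
    using prob_densityD[OF Pdata] prob_densityD[OF mix[OF that]]
    by (auto simp: a_def split: bool.splits)
  have b_props: "integrable \<mu> (b G m)" "x \<in> space \<mu> \<Longrightarrow> 0 \<le> b G m x"
    if "G \<in> \<G>" "m \<in> {1..M}" for G m x
    using prob_densityD[OF dens[OF that]] w[OF that(2)] by (auto simp: b_def[abs_def])
  have U_le: "U G D \<le> ereal (u G)" if G: "G \<in> \<G>" and D: "D \<in> discriminators \<mu>" for G D
  proof -
    have "ennreal (split_entropy \<mu> UNIV (a G)) \<le> cross_loss \<mu> UNIV (a G) (case_bool D (\<lambda>x. 1 - D x))"
      using D a_props[OF G]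
      by (intro split_entropy_le_cross_loss)
        (auto simp: discriminators_iff UNIV_bool split: bool.splits)
    \<comment> \<open>Nonnegativity of the entropy ensures that the passage through
      \<open>ennreal\<close> did not truncate it.\<close>
    then have "ereal (split_entropy \<mu> UNIV (a G)) \<le>
        enn2ereal (cross_loss \<mu> UNIV (a G) (case_bool D (\<lambda>x. 1 - D x)))"
      using split_entropy_nonneg[of UNIV \<mu> "a G"] a_props[OF G]
      by (simp add: less_eq_ennreal.rep_eq enn2ereal_ennreal)
    then show ?thesis by (simp add: U_def u_def ereal_uminus_le_reorder flip: uminus_ereal.simps)
  qed
  have U_max: "\<exists>D\<in>discriminators \<mu>. U G D = ereal (u G)" if G: "G \<in> \<G>" for G
  proof -
    have "0 \<le> split_entropy \<mu> UNIV (a G)"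
      using a_props[OF G] by (intro split_entropy_nonneg) auto
    with bayes_discriminator[OF Pdata mix[OF G]] show ?thesis
      by (metis U_def u_def a_def enn2ereal_ennreal uminus_ereal.simps(1))
  qed
  have L_ge: "ereal (l G) \<le> L G C" if G: "G \<in> \<G>" and C: "C \<in> classifiers \<mu> M" for G C
  proof -
    have "ennreal (split_entropy \<mu> {1..M} (b G)) \<le> cross_loss \<mu> {1..M} (b G) C"
      using classifiersD[OF C] b_props[OF G] by (intro split_entropy_le_cross_loss) auto
    then have "ereal (split_entropy \<mu> {1..M} (b G)) \<le> enn2ereal (cross_loss \<mu> {1..M} (b G) C)"
      using split_entropy_nonneg[of "{1..M}" \<mu> "b G"] b_props[OF G]
      by (simp add: less_eq_ennreal.rep_eq enn2ereal_ennreal)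
    then have "ereal lam * ereal (split_entropy \<mu> {1..M} (b G)) \<le> L G C"
      unfolding L_def using lam by (intro ereal_mult_left_mono) auto
    then show ?thesis by (simp add: l_def)
  qed
  have L_min: "\<exists>C\<in>classifiers \<mu> M. L G C = ereal (l G)" if G: "G \<in> \<G>" for G
  proof -
    have "0 \<le> split_entropy \<mu> {1..M} (b G)"
      using b_props[OF G] by (intro split_entropy_nonneg) auto
    moreover have "\<exists>C\<in>classifiers \<mu> M. cross_loss \<mu> {1..M} (b G) C = ennreal (split_entropy \<mu> {1..M} (b G))"
      unfolding b_def[abs_def] using dens[OF G] w w1 by (intro bayes_classifier) auto
    ultimately show ?thesis
      by (metis L_def l_def enn2ereal_ennreal times_ereal.simps(1))
  qed
  have value_eq: "u G + l G = J G + k" if G: "G \<in> \<G>" for G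
  proof -
    have "gen_JSD \<mu> M w (\<lambda>m. dens (G m)) = - split_entropy \<mu> {1..M} (b G) - (\<Sum>m=1..M. w m * ln (w m))"
      unfolding b_def[abs_def] using sf dens[OF G] w by (intro gen_JSD_eq_split_entropy) auto
    moreover have "2 * JSD \<mu> Pdata (mixture M w (\<lambda>m. dens (G m))) = 2 * ln 2 - split_entropy \<mu> UNIV (a G)"
      unfolding a_def using sf Pdata mix[OF G] by (rule JSD_eq_split_entropy)
    ultimately show ?thesis
      unfolding u_def l_def J_def JSD_objective_def k_def by (simp only:) (simp add: right_diff_distrib)
  qed
  \<comment> \<open>\<open>D\<close> and \<open>C\<close> are only assumed to be best responses to
    each other; separability still forces the value \<open>u G + l G\<close>.\<close>
  have equilibrium: "V G C D = ereal (J G + k)"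
    if "G \<in> \<G>" "is_arg_max (V G C) (\<lambda>D. D \<in> discriminators \<mu>) D"
      "is_arg_min (\<lambda>C. V G C D) (\<lambda>C. C \<in> classifiers \<mu> M) C" for G C D
    using separable_equilibrium_value[where v = "V G" and U = "U G" and L = "L G"
        and \<C> = "classifiers \<mu> M" and \<D> = "discriminators \<mu>", OF V_eq[OF that(1)] U_le[OF that(1)] U_max[OF that(1)]
        L_ge[OF that(1)] L_min[OF that(1)] that(2,3)]
    by (simp add: value_eq[OF that(1)])
  have sup: "(SUP D\<in>discriminators \<mu>. V G C D) = ereal (u G) + L G C"
    if "G \<in> \<G>" "C \<in> classifiers \<mu> M" for G C
    using separable_SUP_value[where v = "V G" and U = "U G" and L = "L G"
        and \<C> = "classifiers \<mu> M" and \<D> = "discriminators \<mu>", OF V_eq[OF that(1)] U_le[OF that(1)] U_max[OF that(1)]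
        L_ge[OF that(1)] L_min[OF that(1)] that(2)] .
  show ?thesis
  proof (intro conjI allI impI)
    \<comment> \<open>Optimal responses chosen for each \<open>G\<close>: the value differs from
      \<open>J\<close> by the constant \<open>k\<close>, so the minimizers agree.\<close>
    fix Dopt Copt
    assume opt: "\<forall>G\<in>\<G>. is_arg_max (\<lambda>D. V G (Copt G) D) (\<lambda>D. D \<in> discriminators \<mu>) (Dopt G) \<and>
                is_arg_min (\<lambda>C. V G C (Dopt G)) (\<lambda>C. C \<in> classifiers \<mu> M) (Copt G)"
    then have eq: "V G (Copt G) (Dopt G) = ereal (J G + k)" if "G \<in> \<G>" for G
      using equilibrium that by auto
    then show "\<exists>c::real. \<forall>G\<in>\<G>. V G (Copt G) (Dopt G) = ereal (J G + c)" by auto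
    show "is_arg_min (\<lambda>G. V G (Copt G) (Dopt G)) (\<lambda>G. G \<in> \<G>) G \<longleftrightarrow> is_arg_min J (\<lambda>G. G \<in> \<G>) G" for G
      using eq by (auto simp: is_arg_min_linorder)
  next
    \<comment> \<open>The minimax game itself: the inner supremum contributes \<open>u G\<close>,
      and the minimum over \<open>C\<close> contributes \<open>l G\<close>.\<close>
    fix G
    show "(\<exists>C. is_arg_min (\<lambda>(G, C). SUP D\<in>discriminators \<mu>. V G C D)
                 (\<lambda>(G, C). G \<in> \<G> \<and> C \<in> classifiers \<mu> M) (G, C)) \<longleftrightarrow>
          is_arg_min J (\<lambda>G. G \<in> \<G>) G"
    proof (rule joint_arg_min_iff[where k = k])
      fix G C assume GC: "G \<in> \<G>" "C \<in> classifiers \<mu> M"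
      have "ereal (u G) + ereal (l G) \<le> ereal (u G) + L G C"
        using L_ge[OF GC] by (rule add_left_mono)
      then show "ereal (J G + k) \<le> (SUP D\<in>discriminators \<mu>. V G C D)"
        using value_eq[OF GC(1)] by (simp add: sup[OF GC])
    next
      fix G assume G: "G \<in> \<G>"
      obtain C where "C \<in> classifiers \<mu> M" "L G C = ereal (l G)" using L_min[OF G] by auto
      then show "\<exists>C\<in>classifiers \<mu> M. (SUP D\<in>discriminators \<mu>. V G C D) = ereal (J G + k)"
        using sup[OF G] value_eq[OF G] by (intro bexI[of _ C]) simp_all
    qed
  qed
qed

end
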